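(* For every integer $m\ge 1$, the Lah triangular matrix ${\rm LM}_m=[L_{i,j}]_{1\le i,j\le m}$ is totally non-negative.
   Context: Lah numbers: for $i,j\in\mathbb{N}_0$, $L_{i,j}$ is the number of ways to partition the set $[i]=\{1,2,\dots,i\}$ into $j$ nonempty tuples, i.e. the number of (unordered) partitions of $[i]$ into $j$ nonempty blocks, each block being equipped with a linear order. By convention $L_{0,0}=1$. The Lah matrix ${\rm LM}_m$ is the $m\times m$ matrix whose entry in row $i$ and column $j$ is $L_{i,j}$, $1\le i,j\le m$ (it is lower triangular). A real matrix is totally non-negative if each of its minors (determinants of square submatrices, of all sizes, with arbitrary sets of row indices and column indices of equal cardinality) is non-negative. *)

theory Defs
  imports
    "HOL-Library.Disjoint_Sets"
    "Jordan_Normal_Form.Determinant"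
    "Jordan_Normal_Form.DL_Submatrix"
begin

text \<open>
  A block with a linear order is a duplicate-free list. A partition of \<open>{1..i}\<close> into ordered
  blocks is a set of such lists whose underlying sets partition \<open>{1..i}\<close>; injectivity of
  \<open>set\<close> says that no block occurs with two different orders. Nonemptiness and disjointness of
  the blocks are part of \<open>partition_on\<close>.
\<close>

definition ordered_block_partitions :: "nat \<Rightarrow> nat \<Rightarrow> nat list set set" where
  "ordered_block_partitions i j =
     {P. (\<forall>xs\<in>P. distinct xs) \<and> inj_on set P \<and> partition_on {1..i} (set ` P) \<and> card P = j}"

definition lah :: "nat \<Rightarrow> nat \<Rightarrow> nat" where
  "lah i j = card (ordered_block_partitions i j)"

text \<open>Matrix indices start at 0, whereas the rows and columns of the Lah matrix start at 1.\<close>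

definition lah_mat :: "nat \<Rightarrow> real mat" where
  "lah_mat m = mat m m (\<lambda>(i, j). real (lah (Suc i) (Suc j)))"

definition totally_nonnegative :: "real mat \<Rightarrow> bool" where
  "totally_nonnegative A \<longleftrightarrow>
     (\<forall>I J. I \<subseteq> {..<dim_row A} \<longrightarrow> J \<subseteq> {..<dim_col A} \<longrightarrow> card I = card J \<longrightarrow>
        0 \<le> det (submatrix A I J))"

end

theory Submission
  imports Defs
begin

text \<open>
  The Lah matrix is Pascal's triangle up to positive diagonal factors:
  \<open>lah (Suc i) (Suc j) = (i + 1)! / (j + 1)! * (i choose j)\<close> (\<open>lah_closed_form\<close>). Pulling the
  factors out of the rows and columns turns a minor of the Lah matrix into a positive multiple of the
  minor of Pascal's triangle with the same rows and columns.

  The closed form follows from a recurrence in \<open>n\<close>. In a partition of \<open>{1..n + 1}\<close> the element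
  \<open>n + 1\<close> either forms a block of its own, or it was inserted into a block of a partition of
  \<open>{1..n}\<close>. A block \<open>xs\<close> offers \<open>length xs + 1\<close> positions, so a partition into \<open>k\<close> blocks offers
  \<open>n + k\<close> positions in total.

  The minors of Pascal's triangle are non-negative by induction on the rows (\<open>pascal_minor_nonneg\<close>).
  By Pascal's rule a row \<open>r + 1\<close> is the row \<open>r\<close> plus the row \<open>r\<close> shifted by one column, hence a
  minor whose rows are all positive is, by multilinearity in the columns, a sum of minors of the
  preceding rows, in each of which some column indices are lowered by 1. Lowering keeps increasing
  column indices weakly increasing, so all summands are again non-negative: they are minors or have
  a repeated column. Row 0 is the first unit vector and is expanded away.
\<close>

section \<open>Determinants\<close>

text \<open>
  Multilinearity in all columns at once: expand the product of sums in each term of the Leibniz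
  formula, choosing the first summand exactly in the columns of \<open>S\<close>.
\<close>

lemma det_columns_add:
  fixes u v :: "nat \<Rightarrow> nat \<Rightarrow> real"
  shows "det (mat n n (\<lambda>(i, j). u i j + v i j)) =
    (\<Sum>S\<in>Pow {..<n}. det (mat n n (\<lambda>(i, j). if j \<in> S then u i j else v i j)))"
proof -
  have split: "(\<Prod>j<n. u (p j) j + v (p j) j) =
      (\<Sum>S\<in>Pow {..<n}. \<Prod>j<n. if j \<in> S then u (p j) j else v (p j) j)" for p
    by (auto simp: prod_add prod.If_cases Int_absorb1 Diff_eq intro!: sum.cong)
  have entry: "(\<Prod>j<n. mat n n (\<lambda>(i, j). w i j) $$ (p j, j)) = (\<Prod>j<n. w (p j) j)"
    if "p permutes {0..<n}" for p and w :: "nat \<Rightarrow> nat \<Rightarrow> real"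
    by (rule prod.cong) (use permutes_in_image[OF that] in auto)
  have leibniz: "det (mat n n (\<lambda>(i, j). w i j)) =
      (\<Sum>p | p permutes {0..<n}. signof p * (\<Prod>j<n. w (p j) j))"
    for w :: "nat \<Rightarrow> nat \<Rightarrow> real"
    by (subst det_col[of _ n]) (auto simp: entry intro!: sum.cong)
  show ?thesis
    unfolding leibniz split sum_distrib_left by (rule sum.swap)
qed

lemma det_scale_rows_columns:
  fixes a b :: "nat \<Rightarrow> real"
  shows "det (mat n n (\<lambda>(i, j). a i * w i j * b j)) =
    (\<Prod>i<n. a i) * (\<Prod>j<n. b j) * det (mat n n (\<lambda>(i, j). w i j))"
proof -
  have entry: "(\<Prod>i = 0..<n. mat n n (\<lambda>(i, j). a i * w i j * b j) $$ (i, p i)) =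
      (\<Prod>i<n. a i) * (\<Prod>j<n. b j) * (\<Prod>i = 0..<n. mat n n (\<lambda>(i, j). w i j) $$ (i, p i))"
    if p: "p permutes {0..<n}" for p
  proof -
    have "(\<Prod>i = 0..<n. mat n n (\<lambda>(i, j). a i * w i j * b j) $$ (i, p i)) =
        (\<Prod>i = 0..<n. a i * b (p i) * mat n n (\<lambda>(i, j). w i j) $$ (i, p i))"
      by (rule prod.cong) (use permutes_in_image[OF p] in auto)
    moreover have "(\<Prod>i = 0..<n. b (p i)) = (\<Prod>j = 0..<n. b j)"
      using prod.permute[OF p, of b] by (simp add: o_def)
    ultimately show ?thesis
      by (simp add: prod.distrib lessThan_atLeast0)
  qed
  show ?thesis
    by (subst (1 2) det_def'[of _ n])
      (auto simp only: mat_carrier entry sum_distrib_left mult.left_commute mem_Collect_eq intro!: sum.cong)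
qed

lemma det_zero_column:
  fixes w :: "nat \<Rightarrow> nat \<Rightarrow> real"
  assumes "t < n" and "\<And>i. i < n \<Longrightarrow> w i t = 0"
  shows "det (mat n n (\<lambda>(i, j). w i j)) = 0"
proof -
  have "(\<Prod>j<n. mat n n (\<lambda>(i, j). w i j) $$ (p j, j)) = 0" if "p permutes {0..<n}" for p
    using permutes_in_image[OF that, of t] assms by (auto intro!: prod_zero bexI[of _ t])
  then show ?thesis
    by (subst det_col[of _ n]) (auto intro!: sum.neutral)
qed

text \<open>Laplace expansion along the first row, of which one term is left.\<close>

lemma det_first_row_supported:
  fixes w :: "nat \<Rightarrow> nat \<Rightarrow> real"
  assumes "\<And>j. 0 < j \<Longrightarrow> j < Suc n \<Longrightarrow> w 0 j = 0"
  shows "det (mat (Suc n) (Suc n) (\<lambda>(i, j). w i j)) =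
    w 0 0 * det (mat n n (\<lambda>(i, j). w (Suc i) (Suc j)))"
proof -
  let ?A = "mat (Suc n) (Suc n) (\<lambda>(i, j). w i j)"
  have minor: "mat_delete ?A 0 0 = mat n n (\<lambda>(i, j). w (Suc i) (Suc j))"
    by (rule eq_matI) (auto simp: mat_delete_def)
  have "det ?A = (\<Sum>j<Suc n. ?A $$ (0, j) * cofactor ?A 0 j)"
    by (rule laplace_expansion_row) auto
  also have "\<dots> = (\<Sum>j\<in>{0}. ?A $$ (0, j) * cofactor ?A 0 j)"
    by (rule sum.mono_neutral_right) (use assms in auto)
  finally show ?thesis
    by (simp add: cofactor_def minor)
qed

section \<open>Minors of Pascal's triangle\<close>

text \<open>
  The column indices are only weakly increasing, because this is what lowering some of them by 1
  preserves. Allowing it costs nothing: if two of them agree, then the determinant vanishes.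
\<close>

lemma pascal_minor_nonneg_aux:
  assumes "strict_mono_on {..<n} r" and "mono_on {..<n} c" and "\<And>i. i < n \<Longrightarrow> r i < N"
  shows "0 \<le> det (mat n n (\<lambda>(i, j). real (r i choose c j)))"
  using assms
proof (induction N arbitrary: n r c)
  case 0
  then have "n = 0" by fastforce
  then show ?case by simp
next
  case (Suc N)
  \<comment> \<open>Rows \<open>1..N\<close> come by Pascal's rule from the rows \<open>0..N - 1\<close>, to which the induction hypothesis
    applies. Strictly increasing column indices stay weakly increasing when some are lowered by 1.\<close>
  have positive_rows: "0 \<le> det (mat k k (\<lambda>(i, j). real (r i choose c j)))"
    if r: "strict_mono_on {..<k} r" and c: "strict_mono_on {..<k} c"
      and bounds: "\<And>i. i < k \<Longrightarrow> 0 < r i \<and> r i < Suc N"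
    for k and r c :: "nat \<Rightarrow> nat"
  proof -
    define s where "s i = r i - 1" for i
    have s: "strict_mono_on {..<k} s" "\<And>i. i < k \<Longrightarrow> s i < N"
      using r bounds by (fastforce simp: s_def strict_mono_on_def intro!: diff_less_mono Suc_leI)+
    \<comment> \<open>Pascal's rule. Column 0 has no left neighbour, and truncated subtraction would name column 0
      itself, so its first summand is set to 0.\<close>
    define u where "u i j = (if c j = 0 then 0 else real (s i choose (c j - 1)))" for i j
    define v where "v i j = real (s i choose c j)" for i j
    have "real (r i choose c j) = u i j + v i j" if "i < k" for i j
    proof -
      have "r i = Suc (s i)" using bounds[OF that] by (simp add: s_def)
      then show ?thesis by (cases "c j") (auto simp: u_def v_def)
    qed
    then have "mat k k (\<lambda>(i, j). real (r i choose c j)) = mat k k (\<lambda>(i, j). u i j + v i j)"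
      by (intro eq_matI) auto
    moreover have "0 \<le> det (mat k k (\<lambda>(i, j). if j \<in> S then u i j else v i j))" for S
    proof (cases "\<exists>t<k. t \<in> S \<and> c t = 0")
      case True
      then obtain t where "t < k" "t \<in> S" "c t = 0" by blast
      then show ?thesis by (subst det_zero_column[of t]) (auto simp: u_def)
    next
      case False
      define d where "d j = (if j \<in> S then c j - 1 else c j)" for j
      have d: "mono_on {..<k} d"
      proof (rule mono_onI)
        fix i j assume "i \<in> {..<k}" "j \<in> {..<k}" "i \<le> j"
        then show "d i \<le> d j"
          using strict_mono_onD[OF c, of i j] by (cases "i = j") (auto simp: d_def)
      qed
      have "mat k k (\<lambda>(i, j). if j \<in> S then u i j else v i j) =
          mat k k (\<lambda>(i, j). real (s i choose d j))"
        using False by (intro eq_matI) (auto simp: u_def v_def d_def)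
      then show ?thesis using Suc.IH[OF s(1) d s(2)] by simp
    qed
    ultimately show ?thesis
      by (simp add: det_columns_add sum_nonneg)
  qed
  show ?case
  proof (cases "strict_mono_on {..<n} c")
    case False
    then obtain i j where ij: "i < n" "j < n" "i < j" "\<not> c i < c j"
      by (auto simp: strict_mono_on_def)
    then have "c i = c j"
      using mono_onD[OF Suc.prems(2), of i j] by simp
    then have "det (mat n n (\<lambda>(i, j). real (r i choose c j))) = 0"
      using ij by (intro det_identical_columns[of _ n i j]) (auto intro!: eq_vecI)
    then show ?thesis by simp
  next
    case c: True
    show ?thesis
    proof (cases "n = 0 \<or> 0 < r 0")
      case True
      have "0 < r i" if "i < n" for i
        using True that strict_mono_onD[OF Suc.prems(1), of 0 i] by (cases "i = 0") auto
      then show ?thesis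
        using positive_rows[OF Suc.prems(1) c] Suc.prems(3) by blast
    next
      case False
      then obtain k where n: "n = Suc k" and r0: "r 0 = 0"
        by (cases n) auto
      have r: "r i < r j" and c: "c i < c j" if "i < j" "j < Suc k" for i j
        using that Suc.prems(1) c n by (auto simp: strict_mono_on_def)
      have "0 \<le> det (mat k k (\<lambda>(i, j). real (r (Suc i) choose c (Suc j))))"
      proof (rule positive_rows)
        show "0 < r (Suc i) \<and> r (Suc i) < Suc N" if "i < k" for i
          using r[of 0 "Suc i"] Suc.prems(3)[of "Suc i"] that n by auto
      qed (auto simp: strict_mono_on_def r c)
      moreover have "det (mat (Suc k) (Suc k) (\<lambda>(i, j). real (r i choose c j))) =
          real (r 0 choose c 0) * det (mat k k (\<lambda>(i, j). real (r (Suc i) choose c (Suc j))))"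
      proof (rule det_first_row_supported)
        fix j :: nat assume "0 < j" "j < Suc k"
        then have "r 0 < c j" using c[of 0 j] r0 by simp
        then show "real (r 0 choose c j) = 0" by (simp add: binomial_eq_0)
      qed
      ultimately show ?thesis using n by simp
    qed
  qed
qed

lemma pascal_minor_nonneg:
  assumes "strict_mono_on {..<n} r" and "mono_on {..<n} c"
  shows "0 \<le> det (mat n n (\<lambda>(i, j). real (r i choose c j)))"
proof (rule pascal_minor_nonneg_aux[OF assms])
  show "r i < Suc (\<Sum>i<n. r i)" if "i < n" for i
    using member_le_sum[of i "{..<n}" r] that by simp
qed

section \<open>Counting partitions into linearly ordered blocks\<close>

text \<open>
  The blocks partition an arbitrary set rather than an initial segment, so that the new element in the
  recurrence can be any element outside the set. Disjointness is required of different lists, not of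
  different underlying sets: as the lists are nonempty, this also says that no block occurs in two
  orders.
\<close>

definition list_partitions :: "'a set \<Rightarrow> nat \<Rightarrow> 'a list set set" where
  "list_partitions A k = {P. (\<forall>xs\<in>P. distinct xs \<and> xs \<noteq> []) \<and>
     pairwise (\<lambda>xs ys. set xs \<inter> set ys = {}) P \<and> \<Union> (set ` P) = A \<and> card P = k}"

lemma list_partitions_disjoint:
  "P \<in> list_partitions A k \<Longrightarrow> xs \<in> P \<Longrightarrow> ys \<in> P \<Longrightarrow> xs \<noteq> ys \<Longrightarrow> set xs \<inter> set ys = {}"
  unfolding list_partitions_def by (auto dest: pairwiseD)

lemma ordered_block_partitions_eq: "ordered_block_partitions i j = list_partitions {1..i} j"
proof -
  have blocks: "inj_on set P \<and> partition_on A (set ` P) \<longleftrightarrow> (\<forall>xs\<in>P. xs \<noteq> []) \<and>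
      (\<forall>xs\<in>P. \<forall>ys\<in>P. xs \<noteq> ys \<longrightarrow> set xs \<inter> set ys = {}) \<and> \<Union> (set ` P) = A"
    for P :: "nat list set" and A
  proof
    assume L: "inj_on set P \<and> partition_on A (set ` P)"
    have "set xs \<inter> set ys = {}" if "xs \<in> P" "ys \<in> P" "xs \<noteq> ys" for xs ys
    proof -
      have "set xs \<noteq> set ys" using L that by (auto dest: inj_onD)
      then show ?thesis
        using L that unfolding partition_on_def disjoint_def by blast
    qed
    moreover have "xs \<noteq> []" if "xs \<in> P" for xs
      using L that unfolding partition_on_def by (metis image_eqI list.set(1))
    ultimately show "(\<forall>xs\<in>P. xs \<noteq> []) \<and>
      (\<forall>xs\<in>P. \<forall>ys\<in>P. xs \<noteq> ys \<longrightarrow> set xs \<inter> set ys = {}) \<and> \<Union> (set ` P) = A"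
      using L by (auto simp: partition_on_def)
  next
    assume R: "(\<forall>xs\<in>P. xs \<noteq> []) \<and>
      (\<forall>xs\<in>P. \<forall>ys\<in>P. xs \<noteq> ys \<longrightarrow> set xs \<inter> set ys = {}) \<and> \<Union> (set ` P) = A"
    then have "inj_on set P"
      by (intro inj_onI) (metis Int_absorb set_empty)
    moreover have "disjoint (set ` P)"
      using R by (intro pairwise_imageI) (auto simp only: disjnt_def)
    ultimately show "inj_on set P \<and> partition_on A (set ` P)"
      unfolding partition_on_def using R by (metis (no_types, lifting) imageE set_empty)
  qed
  have "P \<in> ordered_block_partitions i j \<longleftrightarrow> P \<in> list_partitions {1..i} j" for P
    using blocks[of P "{1..i}"]
    unfolding ordered_block_partitions_def list_partitions_def pairwise_def ball_conj_distrib mem_Collect_eq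
    by argo
  then show ?thesis by blast
qed

lemma finite_blocks:
  assumes "finite A"
  shows "finite {xs. distinct xs \<and> set xs \<subseteq> A}"
proof (rule finite_subset)
  show "{xs. distinct xs \<and> set xs \<subseteq> A} \<subseteq> {xs. set xs \<subseteq> A \<and> length xs \<le> card A}"
  proof safe
    fix xs :: "'a list" assume "distinct xs" and sub: "set xs \<subseteq> A"
    then show "length xs \<le> card A"
      using card_mono[OF assms sub] by (simp only: distinct_card)
  qed
  show "finite {xs. set xs \<subseteq> A \<and> length xs \<le> card A}"
    using assms by (rule finite_lists_length_le)
qed

lemma list_partitions_subset: "list_partitions A k \<subseteq> Pow {xs. distinct xs \<and> set xs \<subseteq> A}"
  by (auto simp: list_partitions_def)

lemma finite_list_partitions: "finite A \<Longrightarrow> finite (list_partitions A k)"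
  by (rule finite_subset[OF list_partitions_subset]) (simp add: finite_blocks)

lemma finite_list_partition: "finite A \<Longrightarrow> P \<in> list_partitions A k \<Longrightarrow> finite P"
  by (rule finite_subset[OF PowD[OF subsetD[OF list_partitions_subset]] finite_blocks])

lemma list_partitions_empty: "list_partitions {} k = (if k = 0 then {{}} else {})"
proof -
  have "P = {}" if "P \<in> list_partitions {} k" for P :: "'a list set"
  proof -
    have "xs \<noteq> []" "set xs = {}" if "xs \<in> P" for xs
      using \<open>P \<in> _\<close> that by (auto simp: list_partitions_def)
    then show ?thesis by auto
  qed
  then show ?thesis by (auto simp: list_partitions_def)
qed

lemma UN_remove: "x \<in> P \<Longrightarrow> \<Union> (f ` P) = f x \<union> \<Union> (f ` (P - {x}))"
  by blast

lemma sum_length_list_partition: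
  assumes "finite A" and P: "P \<in> list_partitions A k"
  shows "(\<Sum>xs\<in>P. length xs) = card A"
proof -
  have "card (\<Union> (set ` P)) = (\<Sum>xs\<in>P. card (set xs))"
    using P finite_list_partition[OF assms]
    by (intro card_UN_disjoint) (simp_all add: list_partitions_disjoint)
  also have "\<dots> = (\<Sum>xs\<in>P. length xs)"
    using P by (intro sum.cong) (auto simp: list_partitions_def distinct_card)
  finally show ?thesis using P by (simp add: list_partitions_def)
qed

text \<open>Adding and removing the block \<open>[a]\<close> are mutually inverse.\<close>

lemma card_list_partitions_singleton_block:
  assumes "finite A" and a: "a \<notin> A"
  shows "card {P \<in> list_partitions (insert a A) (Suc k). [a] \<in> P} = card (list_partitions A k)"
proof (rule sym, rule bij_betw_same_card[of "insert [a]"], rule bij_betw_byWitness[of _ "\<lambda>P. P - {[a]}"])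
  have notin: "[a] \<notin> Q" if "Q \<in> list_partitions A k" for Q
    using that a by (auto simp: list_partitions_def)
  then show "\<forall>Q\<in>list_partitions A k. insert [a] Q - {[a]} = Q" by auto
  show "\<forall>P\<in>{P \<in> list_partitions (insert a A) (Suc k). [a] \<in> P}. insert [a] (P - {[a]}) = P" by auto
  show "insert [a] ` list_partitions A k \<subseteq> {P \<in> list_partitions (insert a A) (Suc k). [a] \<in> P}"
  proof safe
    fix Q assume Q: "Q \<in> list_partitions A k"
    then have "card (insert [a] Q) = Suc k"
      using notin[OF Q] finite_list_partition[OF assms(1) Q] by (simp add: list_partitions_def)
    then show "insert [a] Q \<in> list_partitions (insert a A) (Suc k)"
      using Q a by (auto simp: list_partitions_def pairwise_insert)
  qed
  show "(\<lambda>P. P - {[a]}) ` {P \<in> list_partitions (insert a A) (Suc k). [a] \<in> P} \<subseteq> list_partitions A k"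
  proof safe
    fix P assume P: "P \<in> list_partitions (insert a A) (Suc k)" and aP: "[a] \<in> P"
    have "\<Union> (set ` (P - {[a]})) = A"
    proof -
      have "a \<notin> set xs" if "xs \<in> P - {[a]}" for xs
        using list_partitions_disjoint[OF P aP, of xs] that by auto
      moreover have "insert a (\<Union> (set ` (P - {[a]}))) = insert a A"
        using UN_remove[OF aP, of set] P by (simp add: list_partitions_def)
      ultimately show ?thesis using a by (metis UN_iff insert_ident)
    qed
    moreover have "card (P - {[a]}) = k"
      using P aP by (simp add: list_partitions_def)
    ultimately show "P - {[a]} \<in> list_partitions A k"
      using P by (auto simp: list_partitions_def intro: pairwise_subset)
  qed
qed

definition insert_at :: "nat \<Rightarrow> 'a \<Rightarrow> 'a list \<Rightarrow> 'a list" where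
  "insert_at i a xs = take i xs @ a # drop i xs"

lemma set_insert_at [simp]: "set (insert_at i a xs) = insert a (set xs)"
  proof -
  have "set (take i xs) \<union> set (drop i xs) = set xs"
    by (metis append_take_drop_id set_append)
  then show ?thesis by (auto simp: insert_at_def)
qed

lemma distinct_insert_at: "a \<notin> set xs \<Longrightarrow> distinct (insert_at i a xs) \<longleftrightarrow> distinct xs"
proof -
  assume "a \<notin> set xs"
  moreover have "distinct (take i xs @ drop i xs) = distinct xs" by simp
  ultimately show ?thesis
    unfolding insert_at_def by (auto dest: in_set_takeD in_set_dropD simp del: append_take_drop_id)
qed

text \<open>The position and the rest of the list can be read off, since \<open>a\<close> occurs only once.\<close>

lemma insert_at_inject:
  assumes "insert_at i a xs = insert_at j a ys" "a \<notin> set xs" "a \<notin> set ys"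
    "i \<le> length xs" "j \<le> length ys"
  shows "xs = ys" "i = j"
proof -
  have tk: "take i xs = take j ys \<and> drop i xs = drop j ys"
    using assms(1-3) unfolding insert_at_def
    by (subst (asm) append_Cons_eq_iff) (auto dest: in_set_takeD in_set_dropD)
  then show "xs = ys" by (metis append_take_drop_id)
  have "length (take i xs) = length (take j ys)" using tk by simp
  then show "i = j" using assms(4,5) by simp
qed

text \<open>
  Every such partition arises in exactly one way by choosing a partition of \<open>A\<close>, one of its blocks
  \<open>xs\<close> and one of the \<open>length xs + 1\<close> positions in it, and inserting \<open>a\<close> there. The number of
  positions, summed over the blocks, is \<open>card A + k\<close> for every partition.
\<close>

lemma card_list_partitions_no_singleton_block:
  assumes "finite A" and a: "a \<notin> A"
  shows "card {P \<in> list_partitions (insert a A) k. [a] \<notin> P} =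
    (card A + k) * card (list_partitions A k)"
proof -
  define D where "D = (SIGMA Q:list_partitions A k. SIGMA xs:Q. {..length xs})"
  define f where "f = (\<lambda>(Q, xs, i). insert (insert_at i a xs) (Q - {xs}))"
  let ?R = "{P \<in> list_partitions (insert a A) k. [a] \<notin> P}"
  have notin: "a \<notin> set xs" if "Q \<in> list_partitions A k" "xs \<in> Q" for Q xs
    using that a by (auto simp: list_partitions_def)
  have "inj_on f D"
  proof (rule inj_onI)
    fix p q assume p: "p \<in> D" and q: "q \<in> D" and eq: "f p = f q"
    obtain Q xs i where p': "p = (Q, xs, i)" by (cases p)
    obtain Q' ys j where q': "q = (Q', ys, j)" by (cases q)
    have Q: "Q \<in> list_partitions A k" "xs \<in> Q" "i \<le> length xs"
      using p p' by (auto simp: D_def)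
    have Q': "Q' \<in> list_partitions A k" "ys \<in> Q'" "j \<le> length ys"
      using q q' by (auto simp: D_def)
    have eq: "insert (insert_at i a xs) (Q - {xs}) = insert (insert_at j a ys) (Q' - {ys})"
      using eq by (simp add: p' q' f_def)
    \<comment> \<open>The block with \<open>a\<close> is the only one that the original partitions do not contain.\<close>
    have old: "insert_at i' a zs \<notin> Q" "insert_at i' a zs \<notin> Q'" for i' zs
      using notin[OF Q(1)] notin[OF Q'(1)] by (metis insertI1 set_insert_at)+
    have new: "insert_at i a xs = insert_at j a ys"
      using eq old by blast
    have "xs = ys" "i = j"
      using insert_at_inject[OF new] notin Q Q' by blast+
    moreover have "Q - {xs} = Q' - {ys}"
      using eq new old by (metis Diff_iff insert_ident)
    ultimately show "p = q"
      using p' q' Q(2) Q'(2) by (metis insert_Diff)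
  qed
  moreover have "f ` D = ?R"
  proof (intro equalityI subsetI)
    fix P assume "P \<in> f ` D"
    then obtain Q xs i where P: "P = insert (insert_at i a xs) (Q - {xs})"
      and Q: "Q \<in> list_partitions A k" and xs: "xs \<in> Q"
      by (auto simp: D_def f_def)
    have fin: "finite Q" using finite_list_partition[OF assms(1) Q] .
    have new: "insert_at i a xs \<notin> Q"
      using notin[OF Q] by (metis insertI1 set_insert_at)
    have "card P = k"
    proof -
      have "card P = Suc (card (Q - {xs}))"
        unfolding P by (rule card_insert_disjoint) (use fin new in auto)
      also have "\<dots> = card Q" using card.remove[OF fin xs] ..
      finally show ?thesis using Q by (simp add: list_partitions_def)
    qed
    moreover have "\<Union> (set ` P) = insert a A"
      using UN_remove[OF xs, of set] Q unfolding P by (simp add: list_partitions_def)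
    moreover have "distinct ys \<and> ys \<noteq> []" if "ys \<in> P" for ys
      using that Q xs distinct_insert_at[OF notin[OF Q xs], of i] unfolding P
      by (auto simp: list_partitions_def insert_at_def)
    moreover have "pairwise (\<lambda>xs ys. set xs \<inter> set ys = {}) P"
    proof -
      have "insert a (set xs) \<inter> set ws = {}" if "ws \<in> Q - {xs}" for ws
        using that notin[OF Q] list_partitions_disjoint[OF Q xs, of ws] by auto
      moreover have "pairwise (\<lambda>xs ys. set xs \<inter> set ys = {}) (Q - {xs})"
        using Q by (auto simp: list_partitions_def intro: pairwise_subset)
      ultimately show ?thesis
        unfolding P pairwise_insert set_insert_at by (metis Int_commute)
    qed
    moreover have "[a] \<notin> P"
    proof
      assume "[a] \<in> P"
      then have "[a] = insert_at i a xs"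
        using notin[OF Q, of "[a]"] unfolding P by auto
      then have "set [a] = insert a (set xs)" by (metis set_insert_at)
      moreover have "xs \<noteq> []" using Q xs by (auto simp: list_partitions_def)
      ultimately show False using notin[OF Q xs] by (cases xs) auto
    qed
    ultimately show "P \<in> ?R" by (simp add: list_partitions_def)
  next
    fix P assume "P \<in> ?R"
    then have P: "P \<in> list_partitions (insert a A) k" and nota: "[a] \<notin> P" by auto
    have fin: "finite P" using finite_list_partition[OF _ P] assms(1) by simp
    obtain Y where Y: "Y \<in> P" "a \<in> set Y"
      using P by (auto simp: list_partitions_def)
    obtain us vs where us: "Y = us @ a # vs" using split_list[OF Y(2)] by blast
    define xs where "xs = us @ vs"
    define Q where "Q = insert xs (P - {Y})"
    have Yd: "distinct Y" using P Y by (auto simp: list_partitions_def)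
    then have xs: "a \<notin> set xs" "distinct xs" "set Y = insert a (set xs)"
      by (auto simp: us xs_def)
    have "xs \<noteq> []" using nota Y us by (auto simp: xs_def)
    have dis: "set Y \<inter> set ws = {}" if "ws \<in> P - {Y}" for ws
      using list_partitions_disjoint[OF P Y(1), of ws] that by blast
    \<comment> \<open>Without this the partition would lose a block when \<open>a\<close> is removed.\<close>
    have xs_new: "xs \<notin> P - {Y}"
    proof
      assume "xs \<in> P - {Y}"
      from dis[OF this] \<open>xs \<noteq> []\<close> xs(3) show False by (cases xs) auto
    qed
    have "card Q = k"
    proof -
      have "card Q = Suc (card (P - {Y}))"
        unfolding Q_def by (rule card_insert_disjoint) (use fin xs_new in auto)
      also have "\<dots> = card P" using card.remove[OF fin Y(1)] ..
      finally show ?thesis using P by (simp add: list_partitions_def)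
    qed
    moreover have "\<Union> (set ` Q) = A"
    proof -
      have "insert a (\<Union> (set ` Q)) = insert a A"
        using UN_remove[OF Y(1), of set] P xs(3) by (simp add: Q_def list_partitions_def)
      moreover have "a \<notin> \<Union> (set ` Q)" using dis Y xs by (auto simp: Q_def)
      ultimately show ?thesis using a by (metis insert_ident)
    qed
    moreover have "distinct ys \<and> ys \<noteq> []" if "ys \<in> Q" for ys
      using that xs \<open>xs \<noteq> []\<close> P by (auto simp: Q_def list_partitions_def)
    moreover have "pairwise (\<lambda>xs ys. set xs \<inter> set ys = {}) Q"
    proof -
      have "set xs \<inter> set ws = {}" if "ws \<in> P - {Y}" for ws
        using dis[OF that] xs by auto
      moreover have "pairwise (\<lambda>xs ys. set xs \<inter> set ys = {}) (P - {Y})"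
        using P by (auto simp: list_partitions_def intro: pairwise_subset)
      ultimately show ?thesis
        unfolding Q_def pairwise_insert by (metis Int_commute)
    qed
    ultimately have "Q \<in> list_partitions A k" by (simp add: list_partitions_def)
    then have "(Q, xs, length us) \<in> D" by (simp add: D_def Q_def xs_def)
    moreover have "f (Q, xs, length us) = P"
    proof -
      have "insert_at (length us) a xs = Y" by (simp add: insert_at_def xs_def us)
      moreover have "Q - {xs} = P - {Y}" using xs_new by (auto simp: Q_def)
      ultimately show ?thesis using Y by (auto simp: f_def)
    qed
    ultimately show "P \<in> f ` D" by force
  qed
  ultimately have "card ?R = card D" by (metis card_image)
  also have "\<dots> = (\<Sum>Q\<in>list_partitions A k. \<Sum>xs\<in>Q. Suc (length xs))"
    unfolding D_def using finite_list_partitions[OF assms(1)] finite_list_partition[OF assms(1)]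
    by (subst card_SigmaI) (auto intro!: sum.cong)
  also have "\<dots> = (\<Sum>Q\<in>list_partitions A k. card A + k)"
  proof (rule sum.cong)
    fix Q assume Q: "Q \<in> list_partitions A k"
    have "(\<Sum>xs\<in>Q. Suc (length xs)) = (\<Sum>xs\<in>Q. length xs) + card Q"
      by (simp add: sum_Suc)
    then show "(\<Sum>xs\<in>Q. Suc (length xs)) = card A + k"
      using sum_length_list_partition[OF assms(1) Q] Q by (simp add: list_partitions_def)
  qed simp
  finally show ?thesis by simp
qed

section \<open>Lah numbers in closed form\<close>

lemma lah_0: "lah 0 k = (if k = 0 then 1 else 0)"
  unfolding lah_def ordered_block_partitions_eq by (simp add: list_partitions_empty)

lemma lah_Suc_0: "lah (Suc n) 0 = 0"
proof -
  have "P \<notin> list_partitions {1..Suc n} 0" for P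
  proof
    assume P: "P \<in> list_partitions {1..Suc n} 0"
    then have "card P = 0" and union: "\<Union> (set ` P) = {1..Suc n}"
      by (simp_all add: list_partitions_def)
    moreover have "finite P" by (rule finite_list_partition[OF _ P]) simp
    ultimately have "P = {}" by simp
    with union have "{1..Suc n} = {}" by simp
    then show False by simp
  qed
  then have "list_partitions {1..Suc n} 0 = {}" by blast
  then show ?thesis by (simp only: lah_def ordered_block_partitions_eq card.empty)
qed

text \<open>The two summands count the partitions with and without the block \<open>[Suc n]\<close>.\<close>

lemma lah_Suc_Suc: "lah (Suc n) (Suc k) = lah n k + (n + Suc k) * lah n (Suc k)"
proof -
  let ?L = "list_partitions {1..Suc n} (Suc k)"
  have ins: "{1..Suc n} = insert (Suc n) {1..n}" by auto
  have fin: "finite ?L" by (rule finite_list_partitions) simp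
  have "?L = {P \<in> ?L. [Suc n] \<in> P} \<union> {P \<in> ?L. [Suc n] \<notin> P}" by blast
  then have "card ?L = card {P \<in> ?L. [Suc n] \<in> P} + card {P \<in> ?L. [Suc n] \<notin> P}"
    using fin by (metis (no_types, lifting) card_Un_disjoint disjoint_iff finite_Un mem_Collect_eq)
  then show ?thesis
    unfolding lah_def ordered_block_partitions_eq ins
    by (simp add: card_list_partitions_singleton_block card_list_partitions_no_singleton_block)
qed

text \<open>
  Both sides satisfy the same recurrence. Stated without division, so that it is an equation of
  natural numbers.
\<close>

lemma lah_closed_form: "fact (Suc k) * lah (Suc n) (Suc k) = fact (Suc n) * (n choose k)"
proof (induction n arbitrary: k)
  case 0
  then show ?case by (cases k) (auto simp: lah_Suc_Suc lah_0)
next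
  case (Suc n)
  show ?case
  proof (cases k)
    case 0
    then show ?thesis using Suc.IH[of 0] by (simp add: lah_Suc_Suc[of "Suc n"] lah_Suc_0)
  next
    case (Suc l)
    \<comment> \<open>The absorption identity \<open>(l + 1) * (n choose (l + 1)) = (n - l) * (n choose l)\<close>, free of
      truncated subtraction. It turns the recurrence into Pascal's rule.\<close>
    have absorb: "Suc l * (n choose Suc l) + l * (n choose l) = n * (n choose l)"
    proof (cases "l \<le> n")
      case True
      have "Suc l * (n choose Suc l) = (n - l) * (n choose l)"
        by (simp only: binomial_absorption binomial_absorb_comp)
      with True show ?thesis by (simp only: add_mult_distrib[symmetric] le_add_diff_inverse2)
    qed (simp add: binomial_eq_0)
    have "fact (Suc k) * lah (Suc (Suc n)) (Suc k) =
        Suc k * (fact (Suc l) * lah (Suc n) (Suc l)) +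
        (Suc n + Suc k) * (fact (Suc k) * lah (Suc n) (Suc k))"
      unfolding lah_Suc_Suc[of "Suc n"] by (simp add: Suc algebra_simps)
    also have "\<dots> = fact (Suc n) *
        (Suc k * (n choose l) + (Suc n + Suc k) * (n choose k))"
      unfolding Suc.IH by (simp only: algebra_simps)
    also have "Suc k * (n choose l) + (Suc n + Suc k) * (n choose k) =
        Suc (Suc n) * (Suc n choose k)"
      using absorb by (simp add: Suc algebra_simps)
    finally show ?thesis by (simp only: fact_Suc[of "Suc n"] of_nat_id mult_ac)
  qed
qed

section \<open>Total non-negativity\<close>

lemma lah_minor_nonneg:
  assumes "strict_mono_on {..<n} r" and "strict_mono_on {..<n} c"
  shows "0 \<le> det (mat n n (\<lambda>(i, j). real (lah (Suc (r i)) (Suc (c j)))))"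
proof -
  have "real (lah (Suc i) (Suc j)) = fact (Suc i) * real (i choose j) * inverse (fact (Suc j))" for i j
  proof -
    have "fact (Suc j) * real (lah (Suc i) (Suc j)) = fact (Suc i) * real (i choose j)"
      using arg_cong[OF lah_closed_form[of j i], of real] by (simp del: fact_Suc)
    moreover have "fact (Suc j) \<noteq> (0 :: real)" by (rule fact_nonzero)
    ultimately show ?thesis by (metis divide_inverse mult.commute nonzero_eq_divide_eq)
  qed
  then have "det (mat n n (\<lambda>(i, j). real (lah (Suc (r i)) (Suc (c j))))) =
      (\<Prod>i<n. fact (Suc (r i))) * (\<Prod>j<n. inverse (fact (Suc (c j)))) *
      det (mat n n (\<lambda>(i, j). real (r i choose c j)))"
    by (simp only: det_scale_rows_columns[of n "\<lambda>i. fact (Suc (r i))"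
        "\<lambda>i j. real (r i choose c j)" "\<lambda>j. inverse (fact (Suc (c j)))"])
  moreover have "0 \<le> (\<Prod>i<n. fact (Suc (r i)) :: real)"
    and "0 \<le> (\<Prod>j<n. inverse (fact (Suc (c j))) :: real)"
    by (simp_all add: prod_nonneg del: fact_Suc)
  moreover have "0 \<le> det (mat n n (\<lambda>(i, j). real (r i choose c j)))"
    using assms(1) strict_mono_on_imp_mono_on[OF assms(2)] by (rule pascal_minor_nonneg)
  ultimately show ?thesis by simp
qed

theorem corollary1:
  fixes m :: nat
  assumes "m \<ge> 1"
  shows "totally_nonnegative (lah_mat m)"
  unfolding totally_nonnegative_def
proof (intro allI impI)
  fix I J
  assume I: "I \<subseteq> {..<dim_row (lah_mat m)}" and J: "J \<subseteq> {..<dim_col (lah_mat m)}"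
    and card: "card I = card J"
  have dims: "{i. i < m \<and> i \<in> I} = I" "{j. j < m \<and> j \<in> J} = J"
    and sub: "I \<subseteq> {..<m}" "J \<subseteq> {..<m}"
    using I J by (auto simp: lah_mat_def)
  have "pick I i < m" "pick J i < m" if "i < card I" for i
    using that sub card pick_in_set_le[of i I] pick_in_set_le[of i J] by auto
  then have "submatrix (lah_mat m) I J =
      mat (card I) (card I) (\<lambda>(i, j). real (lah (Suc (pick I i)) (Suc (pick J j))))"
    unfolding submatrix_def using card by (intro eq_matI) (auto simp: lah_mat_def dims)
  moreover have "strict_mono_on {..<card I} (pick I)" "strict_mono_on {..<card I} (pick J)"
    using card by (auto simp: strict_mono_on_def pick_mono_le)
  ultimately show "0 \<le> det (submatrix (lah_mat m) I J)"
    by (simp add: lah_minor_nonneg)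
qed

end
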